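(* Let $\ell\ge1$ and $0\le k\le\ell$ be integers, and suppose that it is not the case that both $k=\ell$ and $\ell$ is even. Then there exists a $(4^{2\ell},\ (4^{\ell}+1)(4^{\ell-1}-1),\ 4^{2\ell-2}-3\cdot4^{\ell-1}-2,\ 4^{2\ell-2}-4^{\ell-1})$-partial difference set (of negative Latin square type) in the group $\mathbb Z_4^{2k}\times\mathbb Z_2^{4\ell-4k}$.
   Context: A $\kappa$-element subset $D$ of a finite (multiplicatively written) group $G$ of order $v$ is a $(v,\kappa,\lambda,\mu)$-partial difference set (PDS) in $G$ if the multiset $\{d_1d_2^{-1}\mid d_1,d_2\in D,\ d_1\ne d_2\}$ contains each nonidentity element of $D$ exactly $\lambda$ times and each nonidentity element of $G\setminus D$ exactly $\mu$ times. A PDS with parameters $(n^2,\ r(n+1),\ -n+r^2+3r,\ r^2+r)$ is called a negative Latin square type PDS; here $n=4^{\ell}$ and $r=4^{\ell-1}-1$. *)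

theory Defs
  imports "HOL-Algebra.Algebra"
begin

text \<open>
  The multiset of quotients \<open>d1 d2\<inverse>\<close> with \<open>d1 \<noteq> d2\<close> in \<open>D\<close>. It is only meaningful for finite \<open>D\<close>,
  since \<^const>\<open>mset_set\<close> of an infinite set is empty.
\<close>

definition quotient_mset :: "('a, 'b) monoid_scheme \<Rightarrow> 'a set \<Rightarrow> 'a multiset" where
  "quotient_mset G D =
     {# d1 \<otimes>\<^bsub>G\<^esub> inv\<^bsub>G\<^esub> d2. (d1, d2) \<in># mset_set {(d1, d2). d1 \<in> D \<and> d2 \<in> D \<and> d1 \<noteq> d2} #}"

text \<open>
  The parameters \<open>\<lambda>\<close> and \<open>\<mu>\<close> are integers: for the empty set the condition on \<open>\<lambda>\<close> is vacuous, and
  the negative Latin square parameters with \<open>r = 0\<close> do have \<open>\<lambda> = -n\<close>.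
\<close>

definition partial_difference_set ::
    "('a, 'b) monoid_scheme \<Rightarrow> 'a set \<Rightarrow> nat \<Rightarrow> nat \<Rightarrow> int \<Rightarrow> int \<Rightarrow> bool" where
  "partial_difference_set G D v \<kappa> lam \<mu> \<longleftrightarrow>
     group G \<and> finite (carrier G) \<and> order G = v \<and>
     D \<subseteq> carrier G \<and> card D = \<kappa> \<and>
     (\<forall>g \<in> D - {\<one>\<^bsub>G\<^esub>}. int (count (quotient_mset G D) g) = lam) \<and>
     (\<forall>g \<in> (carrier G - D) - {\<one>\<^bsub>G\<^esub>}. int (count (quotient_mset G D) g) = \<mu>)"

definition negative_Latin_square_PDS :: "('a, 'b) monoid_scheme \<Rightarrow> 'a set \<Rightarrow> nat \<Rightarrow> nat \<Rightarrow> bool" where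
  "negative_Latin_square_PDS G D n r \<longleftrightarrow>
     partial_difference_set G D (n\<^sup>2) (r * (n + 1))
       (- int n + (int r)\<^sup>2 + 3 * int r) ((int r)\<^sup>2 + int r)"

text \<open>The direct power \<open>\<int>\<^sub>m\<^sup>j\<close>.\<close>

definition cyclic_power :: "nat \<Rightarrow> nat \<Rightarrow> (nat \<Rightarrow> int) monoid" where
  "cyclic_power m j = product_group {..<j} (\<lambda>_. integer_mod_group m)"

end

theory Submission
  imports Defs
begin

text \<open>
  Over the field \<open>F\<close> with four elements, the nonzero singular vectors of an elliptic quadratic form
  in \<open>2l\<close> variables are a negative Latin square type partial difference set in \<open>\<int>\<^sub>2\<^bsup>4l\<^esup>\<close>. The form
  itself can be forgotten if one remembers the three signs \<open>s\<^sub>0, s\<^sub>1, s\<^sub>2\<close> obtained by applying to its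
  value the three nontrivial additive characters of \<open>F\<close>. What matters is how these functions
  correlate: each is orthogonal to its nontrivial translates, and two distinct ones correlate to a
  constant multiple \<open>m\<close> of the third (see \<open>bent_triple\<close>). A vector is singular iff all three signs
  are 1, so its indicator is \<open>(1 + s\<^sub>0 + s\<^sub>1 + s\<^sub>2) / 4\<close>, and expanding the autocorrelation of this
  expression gives an affine function of the same indicator. This is the partial difference set
  property; it has the required parameters when \<open>m = - (4 ^ l)\<close>
  (see \<open>bent_triple_partial_difference_set\<close>).

  The correlation identities make sense on every group, and they pass to direct products: triples
  are multiplied pointwise, and the constants \<open>m\<close> are multiplied too. Hence \<open>l\<close> blocks of order 16
  with \<open>m = \<plusminus>4\<close> suffice. On \<open>\<int>\<^sub>2\<^sup>4\<close> the binary elliptic and hyperbolic forms over \<open>F\<close> supply \<open>- 4\<close>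
  and \<open>4\<close>; on \<open>\<int>\<^sub>4\<^sup>2\<close> a partition of the nonidentity elements into three five-element sets supplies
  \<open>- 4\<close>. With \<open>k\<close> blocks \<open>\<int>\<^sub>4\<^sup>2\<close> and elliptic blocks otherwise, the product is \<open>(- 4) ^ l\<close>, which is
  right for odd \<open>l\<close>. For even \<open>l\<close> one hyperbolic block corrects the sign, and the hypothesis on
  \<open>k\<close> ensures that a block \<open>\<int>\<^sub>2\<^sup>4\<close> is present.
\<close>

section \<open>Triples of sign functions\<close>

definition correlation :: "('a, 'b) monoid_scheme \<Rightarrow> ('a \<Rightarrow> int) \<Rightarrow> ('a \<Rightarrow> int) \<Rightarrow> 'a \<Rightarrow> int" where
  "correlation G s t g = (\<Sum>y\<in>carrier G. s (g \<otimes>\<^bsub>G\<^esub> y) * t y)"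

text \<open>
  The indices \<open>0, 1, 2\<close> stand for the nontrivial characters of the Klein four-group, so that
  \<open>3 - i - j\<close> is the index of the product of two distinct ones. For abelian \<open>G\<close>, the correlation
  conditions say that the Fourier transforms satisfy \<open>|S\<^sub>i|\<^sup>2 = m\<^sup>2\<close> and that \<open>S\<^sub>i\<close> times the conjugate
  of \<open>S\<^sub>j\<close> is \<open>m S\<^sub>k\<close>: each \<open>s\<^sub>i\<close> is bent, and the duals \<open>S\<^sub>i / m\<close> again multiply like characters.
  Stated on \<open>G\<close> itself, they can be verified and used without Fourier analysis.
\<close>

definition bent_triple ::
    "('a, 'b) monoid_scheme \<Rightarrow> int \<Rightarrow> (nat \<Rightarrow> 'a \<Rightarrow> int) \<Rightarrow> bool" where
  "bent_triple G m s \<longleftrightarrow>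
     (\<forall>i<3. s i \<one>\<^bsub>G\<^esub> = 1) \<and>
     (\<forall>i<3. \<forall>x\<in>carrier G. s i x = 1 \<or> s i x = - 1) \<and>
     (\<forall>x\<in>carrier G. s 0 x * s 1 x * s 2 x = 1) \<and>
     (\<forall>i<3. \<forall>j<3. \<forall>g\<in>carrier G. correlation G (s i) (s j) g =
        (if i = j then if g = \<one>\<^bsub>G\<^esub> then m\<^sup>2 else 0 else m * s (3 - i - j) g))"

definition has_bent_triple :: "('a, 'b) monoid_scheme \<Rightarrow> int \<Rightarrow> bool" where
  "has_bent_triple G m \<longleftrightarrow> group G \<and> finite (carrier G) \<and> (\<exists>s. bent_triple G m s)"

lemma bent_tripleD:
  assumes "bent_triple G m s" "i < 3"
  shows "s i \<one>\<^bsub>G\<^esub> = 1"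
    and "x \<in> carrier G \<Longrightarrow> s i x = 1 \<or> s i x = - 1"
    and "x \<in> carrier G \<Longrightarrow> s 0 x * s 1 x * s 2 x = 1"
    and "j < 3 \<Longrightarrow> g \<in> carrier G \<Longrightarrow> correlation G (s i) (s j) g =
        (if i = j then if g = \<one>\<^bsub>G\<^esub> then m\<^sup>2 else 0 else m * s (3 - i - j) g)"
  using assms unfolding bent_triple_def by blast+

text \<open>
  The correlation of two functions that are products over the factors is the product of the
  correlations, so every defining identity holds factorwise.
\<close>

lemma has_bent_triple_DirProd:
  assumes "has_bent_triple G m" "has_bent_triple H n"
  shows "has_bent_triple (G \<times>\<times> H) (m * n)"
proof -
  obtain s t where G: "group G" "finite (carrier G)" and s: "bent_triple G m s"
    and H: "group H" "finite (carrier H)" and t: "bent_triple H n t"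
    using assms unfolding has_bent_triple_def by blast
  define st where "st i = (\<lambda>(x, y). s i x * t i y)" for i :: nat
  have st: "st i (x, y) = s i x * t i y" for i x y
    by (simp add: st_def)
  have corr: "correlation (G \<times>\<times> H) (st i) (st j) (g, h) =
      correlation G (s i) (s j) g * correlation H (t i) (t j) h" for i j g h
    by (simp add: correlation_def st_def sum_product sum.cartesian_product case_prod_beta mult_DirProd' mult_ac)
  have "bent_triple (G \<times>\<times> H) (m * n) st"
    unfolding bent_triple_def
  proof (intro conjI allI impI ballI)
    fix i :: nat
    assume i: "i < 3"
    show "st i \<one>\<^bsub>G \<times>\<times> H\<^esub> = 1"
      using bent_tripleD(1)[OF s i] bent_tripleD(1)[OF t i] by (simp add: st_def)
    fix x
    assume "x \<in> carrier (G \<times>\<times> H)"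
    then show "st i x = 1 \<or> st i x = - 1"
      using bent_tripleD(2)[OF s i, of "fst x"] bent_tripleD(2)[OF t i, of "snd x"]
      by (auto simp: st_def)
  next
    fix x
    assume "x \<in> carrier (G \<times>\<times> H)"
    then have "s 0 (fst x) * s 1 (fst x) * s 2 (fst x) = 1" "t 0 (snd x) * t 1 (snd x) * t 2 (snd x) = 1"
      using bent_tripleD(3)[OF s, of 0 "fst x"] bent_tripleD(3)[OF t, of 0 "snd x"] by auto
    then have "(s 0 (fst x) * s 1 (fst x) * s 2 (fst x)) * (t 0 (snd x) * t 1 (snd x) * t 2 (snd x)) = 1"
      by simp
    then show "st 0 x * st 1 x * st 2 x = 1"
      by (simp add: st_def case_prod_beta mult_ac)
  next
    fix i j :: nat and g
    assume ij: "i < 3" "j < 3" and g: "g \<in> carrier (G \<times>\<times> H)"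
    obtain a b where ab: "g = (a, b)" "a \<in> carrier G" "b \<in> carrier H"
      using g by auto
    show "correlation (G \<times>\<times> H) (st i) (st j) g =
        (if i = j then if g = \<one>\<^bsub>G \<times>\<times> H\<^esub> then (m * n)\<^sup>2 else 0 else m * n * st (3 - i - j) g)"
      using bent_tripleD(4)[OF s ij(1,2) ab(2)] bent_tripleD(4)[OF t ij(1,2) ab(3)]
      by (simp add: ab(1) corr st power_mult_distrib)
  qed
  then show ?thesis
    unfolding has_bent_triple_def using G H by (auto simp: DirProd_group)
qed

lemma has_bent_triple_iso:
  assumes "has_bent_triple H m" "group G" "G \<cong> H"
  shows "has_bent_triple G m"
proof -
  obtain s \<phi> where H: "group H" "finite (carrier H)" and s: "bent_triple H m s"
    and \<phi>: "\<phi> \<in> iso G H"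
    using assms unfolding has_bent_triple_def is_iso_def by blast
  interpret group_hom G H \<phi>
    using assms(2) H(1) \<phi> by (simp add: group_hom_def group_hom_axioms_def iso_def)
  have bij: "bij_betw \<phi> (carrier G) (carrier H)"
    using \<phi> by (simp add: iso_def)
  have one: "\<phi> x = \<one>\<^bsub>H\<^esub> \<longleftrightarrow> x = \<one>\<^bsub>G\<^esub>" if "x \<in> carrier G" for x
    using bij that hom_one by (metis G.one_closed bij_betw_imp_inj_on inj_onD)
  have corr: "correlation G (\<lambda>x. u (\<phi> x)) (\<lambda>x. v (\<phi> x)) g = correlation H u v (\<phi> g)"
    if "g \<in> carrier G" for u v g
    unfolding correlation_def sum.reindex_bij_betw[OF bij, symmetric] using that by simp
  have "bent_triple G m (\<lambda>i x. s i (\<phi> x))"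
    using s unfolding bent_triple_def by (simp add: corr one)
  then show ?thesis
    unfolding has_bent_triple_def using assms(2) H(2) bij_betw_finite[OF bij] by blast
qed

section \<open>Powers of cyclic groups\<close>

lemma cyclic_power_group [simp]: "group (cyclic_power m j)"
  by (simp add: cyclic_power_def)

lemma cyclic_power_add_iso: "cyclic_power m (a + b) \<cong> cyclic_power m a \<times>\<times> cyclic_power m b"
proof -
  let ?C = "carrier (integer_mod_group m)"
  define \<phi> :: "(nat \<Rightarrow> int) \<Rightarrow> _" where "\<phi> x = (restrict x {..<a}, \<lambda>i\<in>{..<b}. x (a + i))" for x
  define \<psi> :: "_ \<Rightarrow> nat \<Rightarrow> int"
    where "\<psi> = (\<lambda>(y, z). \<lambda>i\<in>{..<a + b}. if i < a then y i else z (i - a))"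
  have "\<phi> \<in> hom (cyclic_power m (a + b)) (cyclic_power m a \<times>\<times> cyclic_power m b)"
    unfolding cyclic_power_def
    by (rule homI) (auto simp: \<phi>_def PiE_iff extensional_def fun_eq_iff)
  moreover have "bij_betw \<phi> ({..<a + b} \<rightarrow>\<^sub>E ?C) (({..<a} \<rightarrow>\<^sub>E ?C) \<times> ({..<b} \<rightarrow>\<^sub>E ?C))"
  proof (rule bij_betw_byWitness[where f' = \<psi>])
    show "\<forall>x\<in>{..<a + b} \<rightarrow>\<^sub>E ?C. \<psi> (\<phi> x) = x"
      by (auto simp: \<phi>_def \<psi>_def PiE_iff extensional_def fun_eq_iff)
    show "\<forall>y\<in>({..<a} \<rightarrow>\<^sub>E ?C) \<times> ({..<b} \<rightarrow>\<^sub>E ?C). \<phi> (\<psi> y) = y"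
      by (auto simp: \<phi>_def \<psi>_def PiE_iff extensional_def fun_eq_iff)
    show "\<phi> ` ({..<a + b} \<rightarrow>\<^sub>E ?C) \<subseteq> ({..<a} \<rightarrow>\<^sub>E ?C) \<times> ({..<b} \<rightarrow>\<^sub>E ?C)"
      by (rule image_subsetI) (simp add: \<phi>_def PiE_iff)
    show "\<psi> ` (({..<a} \<rightarrow>\<^sub>E ?C) \<times> ({..<b} \<rightarrow>\<^sub>E ?C)) \<subseteq> {..<a + b} \<rightarrow>\<^sub>E ?C"
      by (rule image_subsetI) (auto simp: \<psi>_def PiE_iff case_prod_beta mem_Times_iff less_diff_conv2)
  qed
  ultimately have "\<phi> \<in> iso (cyclic_power m (a + b)) (cyclic_power m a \<times>\<times> cyclic_power m b)"
    by (simp add: iso_def cyclic_power_def)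
  then show ?thesis
    unfolding is_iso_def by blast
qed

lemma cyclic_power_one_iso: "cyclic_power m 1 \<cong> integer_mod_group m"
proof -
  let ?C = "carrier (integer_mod_group m)"
  have "bij_betw (\<lambda>x. x 0) ({..<1::nat} \<rightarrow>\<^sub>E ?C) ?C"
    by (rule bij_betw_byWitness[where f' = "\<lambda>c. \<lambda>i\<in>{..<1}. c"])
      (auto simp: PiE_iff extensional_def fun_eq_iff)
  then have "(\<lambda>x. x 0) \<in> iso (cyclic_power m 1) (integer_mod_group m)"
    by (auto simp: iso_def cyclic_power_def intro!: homI)
  then show ?thesis
    unfolding is_iso_def by blast
qed

lemma cyclic_power_two_iso:
  "cyclic_power m 2 \<cong> integer_mod_group m \<times>\<times> integer_mod_group m"
proof -
  have "cyclic_power m 2 \<cong> cyclic_power m 1 \<times>\<times> cyclic_power m 1"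
    using cyclic_power_add_iso[of m 1 1] by (simp add: numeral_2_eq_2)
  also have "cyclic_power m 1 \<times>\<times> cyclic_power m 1 \<cong> integer_mod_group m \<times>\<times> integer_mod_group m"
    by (intro group.DirProd_iso_trans) (auto intro: cyclic_power_one_iso[simplified])
  finally (iso_trans) show ?thesis .
qed

lemma has_bent_triple_trivial: "has_bent_triple (cyclic_power m 0) 1"
proof -
  have "bent_triple (cyclic_power m 0) 1 (\<lambda>i x. 1)"
    by (simp add: bent_triple_def correlation_def cyclic_power_def restrict_def)
  then show ?thesis
    unfolding has_bent_triple_def by (auto simp: cyclic_power_def)
qed

lemma has_bent_triple_cyclic_power_add:
  assumes "has_bent_triple (cyclic_power m a) p" "has_bent_triple (cyclic_power m b) q"
  shows "has_bent_triple (cyclic_power m (a + b)) (p * q)"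
  using has_bent_triple_iso[OF has_bent_triple_DirProd[OF assms] cyclic_power_group cyclic_power_add_iso] .

lemma has_bent_triple_cyclic_power_mult:
  assumes "has_bent_triple (cyclic_power m a) p"
  shows "has_bent_triple (cyclic_power m (j * a)) (p ^ j)"
proof (induction j)
  case 0
  show ?case by (simp add: has_bent_triple_trivial)
next
  case (Suc j)
  then show ?case
    using has_bent_triple_cyclic_power_add[OF assms Suc] by simp
qed

section \<open>Blocks of order 16\<close>

lemma all_less_3: "(\<forall>i<3. P i) \<longleftrightarrow> P 0 \<and> P 1 \<and> P (2::nat)"
  by (auto simp: numeral_3_eq_3 numeral_2_eq_2 less_Suc_eq)

text \<open>
  The three five-element sets below partition the nonidentity elements of \<open>\<int>\<^sub>4\<^sup>2\<close>, and each \<open>s i\<close> is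
  \<open>1\<close> exactly on one of them and at the identity. Each set has the form \<open>{\<plusminus>u, \<plusminus>v, 2u + 2v}\<close> with
  \<open>u, v\<close> a basis, so that its Cayley graph is the folded 5-cube (the Clebsch graph); the
  automorphism \<open>(x, y) \<mapsto> (-y, x - y)\<close> of order 3 permutes the three sets cyclically. They decompose
  the complete graph on 16 vertices just as, on \<open>\<int>\<^sub>2\<^sup>4\<close>, the level sets of the elliptic quadratic
  form at its three nonzero values do, and so this block can replace an elliptic one.
\<close>

lemma has_bent_triple_Z4: "has_bent_triple (cyclic_power 4 2) (- 4)"
proof -
  let ?Z = "integer_mod_group 4"
  define D :: "nat \<Rightarrow> (int \<times> int) set" where
    "D i = (if i = 0 then {(1, 0), (3, 0), (2, 1), (2, 3), (2, 2)}
       else if i = 1 then {(0, 1), (0, 3), (1, 3), (3, 1), (2, 0)}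
       else {(1, 1), (3, 3), (1, 2), (3, 2), (0, 2)})" for i
  define s :: "nat \<Rightarrow> int \<times> int \<Rightarrow> int" where
    "s i x = (if x \<in> insert (0, 0) (D i) then 1 else - 1)" for i x
  have C: "carrier ?Z = {0, 1, 2, 3}"
    by (auto simp: carrier_integer_mod_group)
  have corr: "correlation (?Z \<times>\<times> ?Z) u v (g, h) =
      (\<Sum>x\<leftarrow>[0, 1, 2, 3]. \<Sum>y\<leftarrow>[0, 1, 2, 3]. u ((g + x) mod 4, (h + y) mod 4) * v (x, y))" for u v g h
    by (simp add: correlation_def C flip: sum.cartesian_product)
  have "bent_triple (?Z \<times>\<times> ?Z) (- 4) s"
    by (simp add: bent_triple_def all_less_3 C corr s_def D_def)
  then have "has_bent_triple (?Z \<times>\<times> ?Z) (- 4)"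
    unfolding has_bent_triple_def by (auto simp: C DirProd_group)
  then show ?thesis
    by (rule has_bent_triple_iso) (simp_all add: cyclic_power_two_iso)
qed

text \<open>
  Write an element of the four-element field as \<open>a + b\<omega>\<close> with \<open>\<omega>\<^sup>2 = \<omega> + 1\<close>. For \<open>x = a + b\<omega>\<close> and
  \<open>y = c + d\<omega>\<close>, the numbers \<open>p\<close> and \<open>q\<close> below are, modulo 2, the coordinates of the quadratic form
  \<open>x y + e (x\<^sup>2 + \<omega> y\<^sup>2)\<close>. It is hyperbolic for \<open>e = 0\<close>. For \<open>e = 1\<close> it is elliptic, since
  \<open>t\<^sup>2 + t + \<omega>\<close> has no root in the field. The three functions are the nontrivial additive characters
  of the field composed with the form. Only the sign of \<open>m\<close> differs between the two cases, so
  hyperbolic and elliptic blocks together reach either sign.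
\<close>

lemma has_bent_triple_Z2: "has_bent_triple (cyclic_power 2 4) (4 - 8 * of_bool e)"
proof -
  let ?Z = "integer_mod_group 2"
  let ?V = "(?Z \<times>\<times> ?Z) \<times>\<times> (?Z \<times>\<times> ?Z)"
  define p q :: "int \<Rightarrow> int \<Rightarrow> int \<Rightarrow> int \<Rightarrow> int" where
    "p a b c d = a * c + b * d + (if e then a + b + d else 0)" and
    "q a b c d = a * d + b * c + b * d + (if e then b + c else 0)" for a b c d
  define s :: "nat \<Rightarrow> (int \<times> int) \<times> (int \<times> int) \<Rightarrow> int" where
    "s i = (\<lambda>((a, b), (c, d)).
       if even (if i = 0 then p a b c d else if i = 1 then q a b c d else p a b c d + q a b c d)
       then 1 else - 1)" for i
  have C: "carrier ?Z = {0, 1}"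
    by (auto simp: carrier_integer_mod_group)
  have corr: "correlation ?V u v ((a, b), (c, d)) =
      (\<Sum>w\<leftarrow>[0, 1]. \<Sum>x\<leftarrow>[0, 1]. \<Sum>y\<leftarrow>[0, 1]. \<Sum>z\<leftarrow>[0, 1].
         u (((a + w) mod 2, (b + x) mod 2), ((c + y) mod 2, (d + z) mod 2)) * v ((w, x), (y, z)))"
    for u v a b c d
    by (simp add: correlation_def C flip: sum.cartesian_product)
  have "bent_triple ?V (4 - 8 * of_bool e) s"
    by (cases e; simp add: bent_triple_def all_less_3 C corr s_def p_def q_def)
  then have "has_bent_triple ?V (4 - 8 * of_bool e)"
    unfolding has_bent_triple_def by (auto simp: C DirProd_group)
  moreover have "cyclic_power 2 4 \<cong> ?V"
  proof -
    have "cyclic_power 2 4 \<cong> cyclic_power 2 2 \<times>\<times> cyclic_power 2 2"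
      using cyclic_power_add_iso[of 2 2 2] by simp
    also have "cyclic_power 2 2 \<times>\<times> cyclic_power 2 2 \<cong> ?V"
      by (intro group.DirProd_iso_trans) (simp_all add: cyclic_power_two_iso)
    finally (iso_trans) show ?thesis .
  qed
  ultimately show ?thesis
    using has_bent_triple_iso cyclic_power_group by blast
qed

text \<open>
  A block of the opposite sign is available as soon as there is one block of rank 4: make it
  hyperbolic and keep the others elliptic.
\<close>

lemma has_bent_triple_Z2_power:
  shows "has_bent_triple (cyclic_power 2 (4 * j)) ((- 4) ^ j)"
    and "j \<ge> 1 \<Longrightarrow> has_bent_triple (cyclic_power 2 (4 * j)) (- ((- 4) ^ j))"
proof -
  have elliptic: "has_bent_triple (cyclic_power 2 (4 * i)) ((- 4) ^ i)" for i
    using has_bent_triple_cyclic_power_mult[OF has_bent_triple_Z2[of True], of i]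
    by (simp add: mult.commute)
  then show "has_bent_triple (cyclic_power 2 (4 * j)) ((- 4) ^ j)" .
  assume "j \<ge> 1"
  then obtain i where i: "j = Suc i"
    by (cases j) auto
  show "has_bent_triple (cyclic_power 2 (4 * j)) (- ((- 4) ^ j))"
    using has_bent_triple_cyclic_power_add[OF has_bent_triple_Z2[of False] elliptic[of i]]
    by (simp add: i)
qed

section \<open>The partial difference set of a triple\<close>

text \<open>
  A quotient \<open>d\<^sub>1 d\<^sub>2\<inverse> = g\<close> is determined by \<open>y = d\<^sub>2\<close>, and then \<open>d\<^sub>1 = g y\<close>. In this form the
  multiplicity of \<open>g\<close> is an autocorrelation of the indicator of \<open>D\<close>.
\<close>

lemma count_quotient_mset:
  fixes G (structure)
  assumes "group G" "finite (carrier G)" "D \<subseteq> carrier G" "g \<in> carrier G" "g \<noteq> \<one>\<^bsub>G\<^esub>"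
  shows "count (quotient_mset G D) g = card {y \<in> carrier G. g \<otimes>\<^bsub>G\<^esub> y \<in> D \<and> y \<in> D}"
proof -
  interpret group G by fact
  let ?P = "{(x, y). x \<in> D \<and> y \<in> D \<and> x \<noteq> y}"
  have "finite D"
    using assms finite_subset by blast
  then have fin: "finite ?P"
    by (rule_tac finite_subset[of _ "D \<times> D"]) auto
  let ?f = "\<lambda>(x, y). x \<otimes> inv y"
  have "count (quotient_mset G D) g = (\<Sum>z | z \<in># mset_set ?P \<and> g = ?f z. count (mset_set ?P) z)"
    unfolding quotient_mset_def by (rule count_image_mset')
  also have "\<dots> = (\<Sum>z\<in>{z \<in> ?P. ?f z = g}. 1)"
    by (rule sum.cong) (use fin in auto)
  also have "\<dots> = card {z \<in> ?P. ?f z = g}"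
    by simp
  also have "{z \<in> ?P. ?f z = g} =
      (\<lambda>y. (g \<otimes> y, y)) ` {y \<in> carrier G. g \<otimes> y \<in> D \<and> y \<in> D}" (is "?L = ?R")
  proof (intro equalityI subsetI)
    fix z
    assume "z \<in> ?L"
    then obtain x y where "z = (x, y)" "x \<in> D" "y \<in> D" "x \<otimes> inv y = g"
      by auto
    moreover from this have "g \<otimes> y = x"
      using assms(3) by (auto simp: m_assoc subset_iff)
    ultimately show "z \<in> ?R"
      using assms(3) by (intro image_eqI[of _ _ y]) auto
  next
    fix z
    assume "z \<in> ?R"
    then show "z \<in> ?L"
      using assms(3-5) by (auto simp: m_assoc)
  qed
  also have "card \<dots> = card {y \<in> carrier G. g \<otimes> y \<in> D \<and> y \<in> D}"
    by (rule card_image) (auto intro: inj_onI)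
  finally show ?thesis .
qed

text \<open>
  Let \<open>\<chi>\<close> be the indicator of the set \<open>E\<close> on which all three functions are 1. Since
  \<open>4 \<chi> = 1 + s\<^sub>0 + s\<^sub>1 + s\<^sub>2\<close>, the autocorrelation of \<open>\<chi>\<close> is a combination of the correlations of the
  \<open>s\<^sub>i\<close>, which away from the identity are multiples of \<open>s\<^sub>0, s\<^sub>1, s\<^sub>2\<close> whose sum is \<open>4 \<chi> - 1\<close>.
  Removing the identity from \<open>E\<close> lowers the count at \<open>g\<close> by \<open>\<chi> g + \<chi> (inv g) = 2 \<chi> g\<close>.
\<close>

lemma bent_triple_partial_difference_set:
  fixes G (structure) and N :: nat
  assumes "has_bent_triple G (- (4 * int N))" and "N \<ge> 1"
  shows "\<exists>D. partial_difference_set G D ((4 * N)\<^sup>2) ((4 * N + 1) * (N - 1))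
           ((int N)\<^sup>2 - 3 * int N - 2) ((int N)\<^sup>2 - int N)"
proof -
  \<comment> \<open>Keeps the index \<open>1\<close> of \<open>s 1\<close> in one syntactic form.\<close>
  note One_nat_def [simp del] One_nat_def [symmetric, simp]
  let ?m = "- (4 * int N)"
  obtain s where "group G" and fin: "finite (carrier G)" and s: "bent_triple G ?m s"
    using assms(1) unfolding has_bent_triple_def by blast
  interpret group G by fact
  define E where "E = {x \<in> carrier G. s 0 x = 1 \<and> s 1 x = 1 \<and> s 2 x = 1}"
  define \<chi> where "\<chi> x = (of_bool (x \<in> E) :: int)" for x
  have one: "s 0 \<one> = 1" "s 1 \<one> = 1" "s 2 \<one> = 1"
    using bent_tripleD(1)[OF s] by simp_all
  then have one_E: "\<one> \<in> E"
    by (simp add: E_def)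
  have corr: "correlation G (s i) (s j) g =
      (if i = j then if g = \<one> then 16 * (int N)\<^sup>2 else 0 else - (4 * int N) * s (3 - i - j) g)"
    if "i < 3" "j < 3" "g \<in> carrier G" for i j g
    using bent_tripleD(4)[OF s that] by (simp add: power_mult_distrib)
  have \<chi>: "4 * \<chi> x = 1 + s 0 x + s 1 x + s 2 x" if "x \<in> carrier G" for x
    using bent_tripleD(2)[OF s, of 0 x] bent_tripleD(2)[OF s, of 1 x]
      bent_tripleD(2)[OF s, of 2 x] bent_tripleD(3)[OF s, of 0 x] that
    by (auto simp: \<chi>_def E_def)
  have prods: "s 1 y * s 2 y = s 0 y" "s 0 y * s 2 y = s 1 y" "s 0 y * s 1 y = s 2 y"
    if "y \<in> carrier G" for y
    using bent_tripleD(2)[OF s, of 0 y] bent_tripleD(2)[OF s, of 1 y]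
      bent_tripleD(2)[OF s, of 2 y] bent_tripleD(3)[OF s, of 0 y] that
    by auto
  \<comment> \<open>At the identity, the correlation of two of the functions is the sum of their product, the third.\<close>
  have total: "(\<Sum>y\<in>carrier G. s 0 y) = - (4 * int N)" "(\<Sum>y\<in>carrier G. s 1 y) = - (4 * int N)"
    "(\<Sum>y\<in>carrier G. s 2 y) = - (4 * int N)"
    using corr[of 1 2 \<one>] corr[of 0 2 \<one>] corr[of 0 1 \<one>]
    by (simp_all add: correlation_def prods one)
  have card_G: "int (card (carrier G)) = 16 * (int N)\<^sup>2"
  proof -
    have "s 0 y * s 0 y = 1" if "y \<in> carrier G" for y
      using bent_tripleD(2)[OF s, of 0 y] that by auto
    then have "correlation G (s 0) (s 0) \<one> = int (card (carrier G))"
      by (simp add: correlation_def)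
    then show ?thesis
      using corr[of 0 0 \<one>] by simp
  qed
  have card_E: "int (card E) = 4 * (int N)\<^sup>2 - 3 * int N"
  proof -
    have "carrier G \<inter> {x. x \<in> E} = E"
      by (auto simp: E_def)
    then have "4 * int (card E) = (\<Sum>y\<in>carrier G. 4 * \<chi> y)"
      using fin by (simp add: \<chi>_def sum_of_bool_eq flip: sum_distrib_left)
    also have "\<dots> = (\<Sum>y\<in>carrier G. 1 + s 0 y + s 1 y + s 2 y)"
      by (rule sum.cong) (simp_all add: \<chi>)
    finally show ?thesis
      by (simp add: sum.distrib total card_G)
  qed
  have translate: "(\<Sum>y\<in>carrier G. u (g \<otimes> y)) = (\<Sum>y\<in>carrier G. u y :: int)"
    if "g \<in> carrier G" for u g
    using sum.reindex_bij_betw[of "(\<otimes>) g" "carrier G" "carrier G" u] that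
    by (simp add: bij_betw_def inj_on_cmult surj_const_mult)
  have corr_\<chi>: "correlation G \<chi> \<chi> g = (int N)\<^sup>2 - int N - 2 * int N * \<chi> g"
    if g: "g \<in> carrier G" "g \<noteq> \<one>" for g
  proof -
    have "16 * correlation G \<chi> \<chi> g = (\<Sum>y\<in>carrier G. (4 * \<chi> (g \<otimes> y)) * (4 * \<chi> y))"
      by (simp add: correlation_def sum_distrib_left)
    also have "\<dots> = (\<Sum>y\<in>carrier G.
        (1 + s 0 (g \<otimes> y) + s 1 (g \<otimes> y) + s 2 (g \<otimes> y)) * (1 + s 0 y + s 1 y + s 2 y))"
      by (rule sum.cong) (simp_all add: \<chi> g)
    also have "\<dots> = int (card (carrier G))
        + (\<Sum>y\<in>carrier G. s 0 (g \<otimes> y)) + (\<Sum>y\<in>carrier G. s 1 (g \<otimes> y)) + (\<Sum>y\<in>carrier G. s 2 (g \<otimes> y))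
        + (\<Sum>y\<in>carrier G. s 0 y) + (\<Sum>y\<in>carrier G. s 1 y) + (\<Sum>y\<in>carrier G. s 2 y)
        + (\<Sum>i\<leftarrow>[0, 1, 2]. \<Sum>j\<leftarrow>[0, 1, 2]. correlation G (s i) (s j) g)"
      by (simp add: correlation_def distrib_left distrib_right sum.distrib)
    also have "\<dots> = 16 * (int N)\<^sup>2 - 24 * int N - 8 * int N * (s 0 g + s 1 g + s 2 g)"
      using g by (simp add: translate total card_G corr algebra_simps)
    also have "\<dots> = 16 * (int N)\<^sup>2 - 24 * int N - 8 * int N * (4 * \<chi> g - 1)"
      using \<chi>[of g] g by simp
    finally show ?thesis
      by (simp add: algebra_simps)
  qed
  \<comment> \<open>Any autocorrelation is symmetric under inversion, and that of \<open>\<chi>\<close> determines \<open>\<chi>\<close> away from \<open>\<one>\<close>.\<close>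
  have inv_\<chi>: "\<chi> (inv g) = \<chi> g" if g: "g \<in> carrier G" for g
  proof -
    have "correlation G \<chi> \<chi> (inv g) = (\<Sum>y\<in>carrier G. \<chi> (inv g \<otimes> (g \<otimes> y)) * \<chi> (g \<otimes> y))"
      unfolding correlation_def by (rule translate[OF g, symmetric])
    also have "\<dots> = correlation G \<chi> \<chi> g"
      unfolding correlation_def by (rule sum.cong) (simp_all add: g flip: m_assoc)
    finally show ?thesis
      using corr_\<chi>[of g] corr_\<chi>[of "inv g"] g assms(2) by (cases "g = \<one>") auto
  qed
  define D where "D = E - {\<one>}"
  have count: "int (count (quotient_mset G D) g) = (int N)\<^sup>2 - int N - (2 * int N + 2) * \<chi> g"
    if g: "g \<in> carrier G" "g \<noteq> \<one>" for g
  proof -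
    have pick: "(\<Sum>y\<in>carrier G. of_bool (y = a) * u y) = u a"
      if "a \<in> carrier G" for a and u :: "_ \<Rightarrow> int"
    proof -
      have "(\<Sum>y\<in>carrier G. of_bool (y = a) * u y) = (\<Sum>y\<in>carrier G. if y = a then u y else 0)"
        by (rule sum.cong) auto
      then show ?thesis
        using fin that by simp
    qed
    have D: "of_bool (x \<in> D) = \<chi> x - of_bool (x = \<one>)" for x
      using one_E by (auto simp: D_def \<chi>_def)
    have "int (count (quotient_mset G D) g) = int (card {y \<in> carrier G. g \<otimes> y \<in> D \<and> y \<in> D})"
      using count_quotient_mset[of G D g] fin g by (auto simp: D_def E_def)
    also have "\<dots> = (\<Sum>y\<in>carrier G. of_bool (g \<otimes> y \<in> D \<and> y \<in> D))"
      using fin by (simp add: sum_of_bool_eq Int_def)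
    also have "\<dots> = (\<Sum>y\<in>carrier G. \<chi> (g \<otimes> y) * \<chi> y
        - of_bool (y = inv g) * \<chi> y - of_bool (y = \<one>) * \<chi> (g \<otimes> y))"
    proof (rule sum.cong)
      fix y
      assume y: "y \<in> carrier G"
      then have "g \<otimes> y = \<one> \<longleftrightarrow> y = inv g"
        using g inv_equality[of g y] by auto
      moreover have "inv g \<noteq> \<one>" "\<one> \<noteq> inv g"
        using g by (metis inv_inv inv_one)+
      ultimately show "of_bool (g \<otimes> y \<in> D \<and> y \<in> D) =
          \<chi> (g \<otimes> y) * \<chi> y - of_bool (y = inv g) * \<chi> y - of_bool (y = \<one>) * \<chi> (g \<otimes> y)"
        unfolding of_bool_conj D using g y one_E by (cases "y = \<one>") (auto simp: \<chi>_def)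
    qed simp
    also have "\<dots> = correlation G \<chi> \<chi> g - \<chi> (inv g) - \<chi> g"
      using g by (simp add: correlation_def sum_subtractf pick)
    finally show ?thesis
      by (simp add: corr_\<chi> inv_\<chi> g algebra_simps)
  qed
  have "card D = (4 * N + 1) * (N - 1)"
  proof -
    have "finite E"
      using fin by (simp add: E_def)
    then have "Suc (card D) = card E"
      unfolding D_def using one_E by (rule card_Suc_Diff1)
    then have "int (card D) = int (card E) - 1"
      by linarith
    also have "\<dots> = (4 * int N + 1) * (int N - 1)"
      by (simp add: card_E algebra_simps power2_eq_square)
    also have "\<dots> = int ((4 * N + 1) * (N - 1))"
      using assms(2) by (simp add: of_nat_diff)
    finally show ?thesis
      by (simp only: of_nat_eq_iff)
  qed
  moreover have "order G = (4 * N)\<^sup>2"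
  proof -
    have "int (order G) = int ((4 * N)\<^sup>2)"
      using card_G by (simp add: order_def power_mult_distrib)
    then show ?thesis
      by (simp only: of_nat_eq_iff)
  qed
  moreover have "D \<subseteq> carrier G"
    by (auto simp: D_def E_def)
  moreover have "\<forall>g\<in>D - {\<one>}. int (count (quotient_mset G D) g) = (int N)\<^sup>2 - 3 * int N - 2"
  proof
    fix g
    assume "g \<in> D - {\<one>}"
    then have "g \<in> carrier G" "g \<noteq> \<one>" "\<chi> g = 1"
      by (auto simp: D_def E_def \<chi>_def)
    then show "int (count (quotient_mset G D) g) = (int N)\<^sup>2 - 3 * int N - 2"
      by (simp add: count)
  qed
  moreover have "\<forall>g\<in>carrier G - D - {\<one>}. int (count (quotient_mset G D) g) = (int N)\<^sup>2 - int N"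
  proof
    fix g
    assume "g \<in> carrier G - D - {\<one>}"
    then have "g \<in> carrier G" "g \<noteq> \<one>" "\<chi> g = 0"
      by (auto simp: D_def \<chi>_def)
    then show "int (count (quotient_mset G D) g) = (int N)\<^sup>2 - int N"
      by (simp add: count)
  qed
  ultimately have "partial_difference_set G D ((4 * N)\<^sup>2) ((4 * N + 1) * (N - 1))
      ((int N)\<^sup>2 - 3 * int N - 2) ((int N)\<^sup>2 - int N)"
    unfolding partial_difference_set_def using fin is_group by simp
  then show ?thesis ..
qed

section \<open>Negative Latin square type sets\<close>

theorem corollary2p2:
  fixes l k :: nat
  assumes "l \<ge> 1" and "k \<le> l" and "\<not> (k = l \<and> even l)"
  shows "\<exists>D. partial_difference_set
               (cyclic_power 4 (2 * k) \<times>\<times> cyclic_power 2 (4 * l - 4 * k)) D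
               (4 ^ (2 * l))
               ((4 ^ l + 1) * (4 ^ (l - 1) - 1))
               (4 ^ (2 * l - 2) - 3 * 4 ^ (l - 1) - 2)
               (4 ^ (2 * l - 2) - 4 ^ (l - 1))
           \<and> negative_Latin_square_PDS
               (cyclic_power 4 (2 * k) \<times>\<times> cyclic_power 2 (4 * l - 4 * k)) D
               (4 ^ l) (4 ^ (l - 1) - 1)"
proof -
  let ?G = "cyclic_power 4 (2 * k) \<times>\<times> cyclic_power 2 (4 * l - 4 * k)"
  define N :: nat where "N = 4 ^ (l - 1)"
  have rest: "4 * l - 4 * k = 4 * (l - k)"
    by simp
  have Z4: "has_bent_triple (cyclic_power 4 (2 * k)) ((- 4) ^ k)"
    using has_bent_triple_cyclic_power_mult[OF has_bent_triple_Z4, of k] by (simp add: mult.commute)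
  have pow: "(- 4 :: int) ^ k * (- 4) ^ (l - k) = (- 4) ^ l"
    by (simp only: power_add[symmetric] le_add_diff_inverse[OF assms(2)])
  have n: "4 ^ l = 4 * N"
    unfolding N_def using assms(1) by (cases l) simp_all
  have N: "(4 :: int) ^ (l - 1) = int N"
    by (simp add: N_def)
  have "int (4 ^ l) = int (4 * N)"
    by (simp only: n)
  then have m: "(4 :: int) ^ l = 4 * int N"
    by simp
  have "has_bent_triple ?G (- (4 ^ l))"
  proof (cases "even l")
    case True
    \<comment> \<open>All blocks elliptic would give \<open>(- 4) ^ l = 4 ^ l\<close>, so one block has to be hyperbolic.\<close>
    then have "l - k \<ge> 1"
      using assms(2,3) by linarith
    then show ?thesis
      using has_bent_triple_DirProd[OF Z4 has_bent_triple_Z2_power(2)[of "l - k"]] pow True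
      by (simp add: rest)
  next
    case False
    then show ?thesis
      using has_bent_triple_DirProd[OF Z4 has_bent_triple_Z2_power(1)[of "l - k"]] pow
      by (simp add: rest)
  qed
  then have triple: "has_bent_triple ?G (- (4 * int N))"
    by (simp only: m)
  have "N \<ge> 1"
    by (simp add: N_def)
  then obtain D where D: "partial_difference_set ?G D ((4 * N)\<^sup>2) ((4 * N + 1) * (N - 1))
      ((int N)\<^sup>2 - 3 * int N - 2) ((int N)\<^sup>2 - int N)"
    using bent_triple_partial_difference_set[OF triple] by blast
  have v: "4 ^ (2 * l) = (4 * N)\<^sup>2"
    by (simp only: power_mult mult.commute[of 2] n)
  have "2 * l - 2 = (l - 1) * 2"
    by simp
  then have N2: "(4 :: int) ^ (2 * l - 2) = (int N)\<^sup>2"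
    by (simp only: power_mult N)
  \<comment> \<open>With \<open>n = 4 * N\<close> and \<open>r = N - 1\<close>, the general negative Latin square parameters are the ones above.\<close>
  have r: "int (N - 1) = int N - 1"
    using \<open>N \<ge> 1\<close> by (simp add: of_nat_diff)
  have "- int (4 * N) + (int (N - 1))\<^sup>2 + 3 * int (N - 1) = (int N)\<^sup>2 - 3 * int N - 2"
    "(int (N - 1))\<^sup>2 + int (N - 1) = (int N)\<^sup>2 - int N"
    unfolding r by (simp_all add: power2_eq_square algebra_simps)
  then have "negative_Latin_square_PDS ?G D (4 * N) (N - 1)"
    unfolding negative_Latin_square_PDS_def using D by (simp only: mult.commute)
  then show ?thesis
    unfolding v N2 N n N_def[symmetric] using D by blast
qed

end
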